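(* Let $\boldsymbol F[\boldsymbol u]_{t,\boldsymbol x}=\boldsymbol 0$ ($t\in\mathcal I$, $\boldsymbol x\in\Omega$) be a system of $m$ PDEs of order $d$ for $\boldsymbol u=(u^1,\dots,u^m)$. Let $\boldsymbol u\in C^{\max(p,q)+\max(r,d)}(\overline{\mathcal I\times\Omega})$ and let $\Lambda=(\lambda^{ij})$ be an $m\times m$ matrix of conservation law multipliers (of order $r$) of the system with corresponding densities $\boldsymbol\psi=(\psi^1,\dots,\psi^m)^T$ and fluxes $\Phi=(\phi^{ji})_{1\le j\le m,\,1\le i\le n}$. Suppose $\Lambda^{\tau,h}$, $D_t^{\tau,h}\boldsymbol\psi$ and $D_{\boldsymbol x}^{\tau,h}\cdot\Phi$ are finite difference discretizations of $\Lambda$, $D_t\boldsymbol\psi$ and $D_{\boldsymbol x}\cdot\Phi$ with accuracy up to order $p$ in space and $q$ in time: $$\big\|\,\|\Lambda[\boldsymbol u]-\Lambda^{\tau,h}\{\boldsymbol u\}\|_{op}\big\|_{l^\infty(\mathcal I^\tau\times\Omega^h)}\le C_\Lambda(h^p+\tau^q),$$ $$\|D_t\boldsymbol\psi[\boldsymbol u]-D_t^{\tau,h}\boldsymbol\psi\{\boldsymbol u\}\|_{l^\infty(\mathcal I^\tau\times\Omega^h)}\le C_t(h^p+\tau^q),$$ $$\|D_{\boldsymbol x}\cdot\Phi[\boldsymbol u]-D_{\boldsymbol x}^{\tau,h}\cdot\Phi\{\boldsymbol u\}\|_{l^\infty(\mathcal I^\tau\times\Omega^h)}\le C_x(h^p+\tau^q).$$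 Let $\boldsymbol u^{\tau,h}:\mathcal I^\tau\times\Omega^h\to\mathbb R^m$ be a discrete function. Suppose $\Lambda^{\tau,h}\{\boldsymbol u^{\tau,h}\}$ is invertible on $\mathcal I^\tau\times\Omega^h$ and that $\big\|\,\|(\Lambda^{\tau,h})^{-1}\{\boldsymbol u^{\tau,h}\}\|_{op}\big\|_{l^\infty(\mathcal I^\tau\times\Omega^h)}\le\gamma<\infty$, with $\gamma$ independent of $\tau,h$. Define the finite difference discretization of $\boldsymbol F$ as $$\boldsymbol F^{\tau,h}\{\boldsymbol u^{\tau,h}\}:=(\Lambda^{\tau,h})^{-1}\{\boldsymbol u^{\tau,h}\}\left(D_t^{\tau,h}\boldsymbol\psi\{\boldsymbol u^{\tau,h}\}+D_{\boldsymbol x}^{\tau,h}\cdot\Phi\{\boldsymbol u^{\tau,h}\}\right).$$ Then there exists a constant $C>0$ independent of $h,\tau$ such that $$\|\boldsymbol F[\boldsymbol u]-\boldsymbol F^{\tau,h}\{\boldsymbol u\}\|_{l^\infty(\mathcal I^\tau\times\Omega^h)}\le C(h^p+\tau^q).$$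
   Context: $\mathcal I=(0,T)$; $\Omega\subset\mathbb R^n$ is a bounded domain. $\boldsymbol F[\boldsymbol u]_{t,\boldsymbol x}\in\mathbb R^m$ denotes the value at $(t,\boldsymbol x)$ of a function (continuous in its arguments) of $t,\boldsymbol x,\boldsymbol u$ and the partial derivatives of $\boldsymbol u$ up to order $d$; similarly for other differential functions. $D_t$, $D_{x_i}$ are total derivatives and $(D_{\boldsymbol x}\cdot\Phi)^j=\sum_{i=1}^nD_{x_i}\phi^{ji}$. $\Lambda$ (analytic entries depending on derivatives of $\boldsymbol u$ up to order $r$) is a matrix of conservation law multipliers with (analytic) densities $\boldsymbol\psi$ and fluxes $\Phi$, depending on derivatives of order at most $\max(r,d)-1$, if $\Lambda[\boldsymbol u]\boldsymbol F[\boldsymbol u]=D_t\boldsymbol\psi[\boldsymbol u]+D_{\boldsymbol x}\cdot\Phi[\boldsymbol u]$ holds identically (not only on solutions). Mesh: $\mathcal I^\tau=\{k\tau:k=0,\dots,\lfloor T/\tau\rfloor\}$ with time step $\tau$, and $\Omega^h=\Omega\cap h\mathbb Z^n$ with mesh size $h$, with points $t_k$, $\boldsymbol x_J$. A finite difference discretization $A^{\tau,h}$ is an expression whose value at $(t_k,\boldsymbol x_J)$ depends on $t_k,\boldsymbol x_J$ and mesh values of its argument: $A^{\tau,h}\{\boldsymbol u^{\tau,h}\}$ is evaluated on the values of a discrete function $\boldsymbol u^{\tau,h}$, and $A^{\tau,h}\{\boldsymbol u\}$, for a continuous function $\boldsymbol u$ on $\overline{\mathcal I\times\Omega}$, is the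 same expression evaluated on the mesh values $\boldsymbol u(t_k,\boldsymbol x_J)$. $\|\cdot\|_{l^\infty(\mathcal I^\tau\times\Omega^h)}$ is the maximum over mesh points of the vector norm $|\cdot|$ (or of a scalar), and $\|\cdot\|_{op}$ is the matrix norm induced by $|\cdot|$. The constants $C_\Lambda,C_t,C_x$ do not depend on $\tau,h$. *)

theory Defs
  imports "HOL-Analysis.Analysis" "HOL-Library.Multiset"
begin

section \<open>Independent variables and partial derivatives\<close>

text \<open>
  A point of space-time is \<open>z = (t, x)\<close> of type \<open>real \<times> (real ^ 'n)\<close>. The independent variables are
  indexed by \<open>'n option\<close>: \<open>None\<close> is the time \<open>t\<close> and \<open>Some i\<close> is the space variable \<open>x_i\<close>.
\<close>

definition var_dir :: "'n::finite option \<Rightarrow> real \<times> (real ^ 'n)" where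
  "var_dir v = (case v of None \<Rightarrow> (1, 0) | Some i \<Rightarrow> (0, axis i 1))"

definition var_val :: "real \<times> (real ^ 'n::finite) \<Rightarrow> 'n option \<Rightarrow> real" where
  "var_val z v = (case v of None \<Rightarrow> fst z | Some i \<Rightarrow> snd z $ i)"

definition partial_deriv ::
  "'n::finite option \<Rightarrow> (real \<times> (real ^ 'n) \<Rightarrow> 'b::real_normed_vector) \<Rightarrow> real \<times> (real ^ 'n) \<Rightarrow> 'b" where
  "partial_deriv v f z = vector_derivative (\<lambda>s. f (z + s *\<^sub>R var_dir v)) (at 0)"

fun iter_partial ::
  "'n::finite option list \<Rightarrow> (real \<times> (real ^ 'n) \<Rightarrow> 'b::real_normed_vector) \<Rightarrow> real \<times> (real ^ 'n) \<Rightarrow> 'b" where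
  "iter_partial [] f = f"
| "iter_partial (v # vs) f = partial_deriv v (iter_partial vs f)"

text \<open>
  The class \<open>C^k\<close> on the closure of an open set \<open>S\<close>: all iterated partial derivatives up to order
  \<open>k\<close> exist on \<open>S\<close> and have continuous extensions to \<open>closure S\<close>; the extension of \<open>u\<close> itself is \<open>u\<close>.
\<close>

definition C_k_closure ::
  "nat \<Rightarrow> (real \<times> (real ^ 'n::finite)) set \<Rightarrow> (real \<times> (real ^ 'n) \<Rightarrow> 'b::real_normed_vector) \<Rightarrow> bool" where
  "C_k_closure k S u \<longleftrightarrow>
     continuous_on (closure S) u \<and>
     (\<forall>vs v z. length vs < k \<longrightarrow> z \<in> S \<longrightarrow>
        (\<lambda>s. iter_partial vs u (z + s *\<^sub>R var_dir v)) differentiable (at 0)) \<and>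
     (\<forall>vs. length vs \<le> k \<longrightarrow>
        (\<exists>g. continuous_on (closure S) g \<and> (\<forall>z\<in>S. g z = iter_partial vs u z)))"

text \<open>
  Multi-indices are multisets of independent variables, of order \<open>size \<alpha>\<close>. For a function of class
  \<open>C^k\<close> with \<open>size \<alpha> \<le> k\<close> the order of differentiation is irrelevant, so any enumeration of \<open>\<alpha>\<close> serves.
  The value on \<open>closure S\<close> is the continuous extension of the derivative in \<open>S\<close>.
\<close>

definition multi_partial ::
  "'n::finite option multiset \<Rightarrow> (real \<times> (real ^ 'n) \<Rightarrow> 'b::real_normed_vector) \<Rightarrow> real \<times> (real ^ 'n) \<Rightarrow> 'b" where
  "multi_partial \<alpha> u = iter_partial (SOME vs. mset vs = \<alpha>) u"

definition closure_partial ::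
  "(real \<times> (real ^ 'n::finite)) set \<Rightarrow> 'n option multiset \<Rightarrow>
   (real \<times> (real ^ 'n) \<Rightarrow> 'b::real_normed_vector) \<Rightarrow> real \<times> (real ^ 'n) \<Rightarrow> 'b" where
  "closure_partial S \<alpha> u z = Lim (at z within S) (multi_partial \<alpha> u)"

lemma closure_partial_interior:
  fixes u :: "real \<times> (real ^ 'n::finite) \<Rightarrow> 'b::real_normed_vector"
  assumes S: "open S" and u: "C_k_closure k S u" and \<alpha>: "size \<alpha> \<le> k" and z: "z \<in> S"
  shows "closure_partial S \<alpha> u z = multi_partial \<alpha> u z"
proof -
  define vs where "vs = (SOME vs. mset vs = \<alpha>)"
  have "mset vs = \<alpha>"
    unfolding vs_def by (rule someI_ex) (rule ex_mset)
  then have "length vs \<le> k"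
    using \<alpha> by auto
  then obtain g where g: "continuous_on (closure S) g" "\<forall>y\<in>S. g y = iter_partial vs u y"
    using u unfolding C_k_closure_def by blast
  have eq: "multi_partial \<alpha> u y = g y" if "y \<in> S" for y
    using g(2) that by (simp add: multi_partial_def vs_def)
  have "continuous_on S g"
    using g(1) closure_subset continuous_on_subset by blast
  then have "(g \<longlongrightarrow> g z) (at z within S)"
    using z by (simp add: continuous_on_def)
  then have lim: "(multi_partial \<alpha> u \<longlongrightarrow> multi_partial \<alpha> u z) (at z within S)"
    unfolding eq[OF z] by (rule Lim_transform_within[of _ _ _ _ 1]) (use eq in auto)
  have "at z within S \<noteq> bot"
    unfolding at_within_open[OF z S] by (rule at_neq_bot)
  then show ?thesis
    unfolding closure_partial_def using lim by (rule tendsto_Lim)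
qed

section \<open>Jet space and differential functions\<close>

text \<open>
  A point of jet space assigns a real number to each independent variable and to each derivative
  \<open>\<partial>^\<alpha> u^j\<close>. A differential function is a function on jet space; its value for \<open>u\<close> at \<open>z\<close>, written
  \<open>f[u]_z\<close> on paper, is \<open>f (jet S u z)\<close>.
\<close>

datatype ('n, 'm) coord = Indep "'n option" | Dep "'n option multiset" 'm

type_synonym ('n, 'm) jet_point = "('n, 'm) coord \<Rightarrow> real"

definition jet ::
  "(real \<times> (real ^ 'n::finite)) set \<Rightarrow> (real \<times> (real ^ 'n) \<Rightarrow> real ^ 'm::finite) \<Rightarrow>
   real \<times> (real ^ 'n) \<Rightarrow> ('n, 'm) jet_point" where
  "jet S u z = (\<lambda>c. case c of Indep v \<Rightarrow> var_val z v | Dep \<alpha> j \<Rightarrow> closure_partial S \<alpha> u z $ j)"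

definition jets_over :: "(real \<times> (real ^ 'n::finite)) set \<Rightarrow> ('n, 'm) jet_point set" where
  "jets_over A = {P. (P (Indep None), \<chi> i. P (Indep (Some i))) \<in> A}"

definition jet_coords :: "nat \<Rightarrow> ('n, 'm) coord set" where
  "jet_coords N = range Indep \<union> {Dep \<alpha> j | \<alpha> j. size \<alpha> \<le> N}"

definition depends_only_on ::
  "('n, 'm) coord set \<Rightarrow> ('n, 'm) jet_point set \<Rightarrow> (('n, 'm) jet_point \<Rightarrow> 'b) \<Rightarrow> bool" where
  "depends_only_on K A f \<longleftrightarrow> (\<forall>P\<in>A. \<forall>Q\<in>A. (\<forall>c\<in>K. P c = Q c) \<longrightarrow> f P = f Q)"

text \<open>
  Real analyticity in the finitely many coordinates \<open>K\<close> at every point of \<open>A\<close>: near each \<open>a \<in> A\<close>,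
  \<open>f\<close> is the sum of an unconditionally convergent power series in the variables \<open>P c - a c\<close>,
  \<open>c \<in> K\<close>. As \<open>P\<close> is unconstrained off \<open>K\<close>, this includes that \<open>f\<close> depends only on
  the coordinates in \<open>K\<close>.
\<close>

definition real_analytic_in ::
  "('n, 'm) coord set \<Rightarrow> ('n, 'm) jet_point set \<Rightarrow> (('n, 'm) jet_point \<Rightarrow> real) \<Rightarrow> bool" where
  "real_analytic_in K A f \<longleftrightarrow>
     (\<forall>a\<in>A. \<exists>\<rho>>0. \<exists>b :: (('n, 'm) coord \<Rightarrow> nat) \<Rightarrow> real.
        \<forall>P. (\<forall>c\<in>K. \<bar>P c - a c\<bar> < \<rho>) \<longrightarrow>
          ((\<lambda>e. b e * (\<Prod>c\<in>K. (P c - a c) ^ e c)) has_sum f P) {e. \<forall>c. c \<notin> K \<longrightarrow> e c = 0})"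

definition coord_deriv ::
  "('n, 'm) coord \<Rightarrow> (('n, 'm) jet_point \<Rightarrow> real) \<Rightarrow> ('n, 'm) jet_point \<Rightarrow> real" where
  "coord_deriv c f P = deriv (\<lambda>s. f (P(c := s))) (P c)"

text \<open>
  The total derivative \<open>D_v f = \<partial>f/\<partial>v + \<Sum> u^j_{\<alpha>+v} \<partial>f/\<partial>u^j_\<alpha>\<close> of a differential function of order at
  most \<open>N\<close>.
\<close>

definition total_deriv ::
  "nat \<Rightarrow> 'n::finite option \<Rightarrow> (('n, 'm::finite) jet_point \<Rightarrow> real) \<Rightarrow> ('n, 'm) jet_point \<Rightarrow> real" where
  "total_deriv N v f P =
     coord_deriv (Indep v) f P +
     (\<Sum>\<alpha> | size \<alpha> \<le> N. \<Sum>j\<in>UNIV. P (Dep (add_mset v \<alpha>) j) * coord_deriv (Dep \<alpha> j) f P)"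

definition total_dt ::
  "nat \<Rightarrow> (('n::finite, 'm::finite) jet_point \<Rightarrow> real ^ 'm) \<Rightarrow> ('n, 'm) jet_point \<Rightarrow> real ^ 'm" where
  "total_dt N \<psi> P = (\<chi> j. total_deriv N None (\<lambda>Q. \<psi> Q $ j) P)"

definition total_div ::
  "nat \<Rightarrow> (('n::finite, 'm::finite) jet_point \<Rightarrow> real ^ 'n ^ 'm) \<Rightarrow> ('n, 'm) jet_point \<Rightarrow> real ^ 'm" where
  "total_div N \<Phi> P = (\<chi> j. \<Sum>i\<in>UNIV. total_deriv N (Some i) (\<lambda>Q. \<Phi> Q $ j $ i) P)"

lemma finite_multisets_size_le: "finite {\<alpha> :: 'a::finite multiset. size \<alpha> \<le> N}"
proof (rule finite_subset)
  show "{\<alpha> :: 'a multiset. size \<alpha> \<le> N} \<subseteq> mset ` {xs. set xs \<subseteq> UNIV \<and> length xs \<le> N}"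
  proof
    fix \<alpha> :: "'a multiset" assume "\<alpha> \<in> {\<alpha>. size \<alpha> \<le> N}"
    moreover obtain xs where "mset xs = \<alpha>" using ex_mset by blast
    ultimately show "\<alpha> \<in> mset ` {xs. set xs \<subseteq> UNIV \<and> length xs \<le> N}" by auto
  qed
  show "finite (mset ` {xs :: 'a list. set xs \<subseteq> UNIV \<and> length xs \<le> N})"
    by (intro finite_imageI finite_lists_length_le) simp
qed

section \<open>Systems of differential equations and conservation law multipliers\<close>

definition pde_system ::
  "(real \<times> (real ^ 'n::finite)) set \<Rightarrow> nat \<Rightarrow> (('n, 'm::finite) jet_point \<Rightarrow> real ^ 'm) \<Rightarrow> bool" where
  "pde_system S d F \<longleftrightarrow>
     continuous_on (jets_over (closure S)) F \<and>
     depends_only_on (jet_coords d) (jets_over (closure S)) F"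

text \<open>
  The identity between multipliers, densities and fluxes is required at every jet over \<open>S\<close>, so not
  only at jets of solutions. Subtraction is truncated: for \<open>r = d = 0\<close> the
  densities and fluxes may have order \<open>0\<close>.
\<close>

definition conservation_law_multipliers ::
  "(real \<times> (real ^ 'n::finite)) set \<Rightarrow> nat \<Rightarrow> nat \<Rightarrow> (('n, 'm::finite) jet_point \<Rightarrow> real ^ 'm) \<Rightarrow>
   (('n, 'm) jet_point \<Rightarrow> real ^ 'm ^ 'm) \<Rightarrow> (('n, 'm) jet_point \<Rightarrow> real ^ 'm) \<Rightarrow>
   (('n, 'm) jet_point \<Rightarrow> real ^ 'n ^ 'm) \<Rightarrow> bool" where
  "conservation_law_multipliers S r d F \<Lambda> \<psi> \<Phi> \<longleftrightarrow>
     (\<forall>i j. real_analytic_in (jet_coords r) (jets_over (closure S)) (\<lambda>P. \<Lambda> P $ i $ j)) \<and>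
     (\<forall>j. real_analytic_in (jet_coords (max r d - 1)) (jets_over (closure S)) (\<lambda>P. \<psi> P $ j)) \<and>
     (\<forall>j i. real_analytic_in (jet_coords (max r d - 1)) (jets_over (closure S)) (\<lambda>P. \<Phi> P $ j $ i)) \<and>
     (\<forall>P \<in> jets_over S.
        \<Lambda> P *v F P = total_dt (max r d - 1) \<psi> P + total_div (max r d - 1) \<Phi> P)"

section \<open>Norms\<close>

definition vector_norm :: "('a::real_vector \<Rightarrow> real) \<Rightarrow> bool" where
  "vector_norm \<nu> \<longleftrightarrow>
     (\<forall>v. 0 \<le> \<nu> v) \<and> (\<forall>v. \<nu> v = 0 \<longleftrightarrow> v = 0) \<and>
     (\<forall>a v. \<nu> (a *\<^sub>R v) = \<bar>a\<bar> * \<nu> v) \<and> (\<forall>v w. \<nu> (v + w) \<le> \<nu> v + \<nu> w)"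

text \<open>
  The analogue of \<^const>\<open>onorm\<close> for an arbitrary norm \<open>\<nu>\<close>; the term \<open>v = 0\<close> contributes \<open>0 / 0 = 0\<close>.
\<close>

definition op_norm :: "(real ^ 'm::finite \<Rightarrow> real) \<Rightarrow> real ^ 'm ^ 'm \<Rightarrow> real" where
  "op_norm \<nu> A = (SUP v. \<nu> (A *v v) / \<nu> v)"

lemma op_norm_norm: "op_norm norm A = onorm (\<lambda>v. A *v v)"
  by (simp add: op_norm_def onorm_def)

text \<open>
  Maximum over a finite set of a nonnegative function; inserting \<open>0\<close> only matters for the empty set.
\<close>

definition linf_norm :: "'a set \<Rightarrow> ('a \<Rightarrow> real) \<Rightarrow> real" where
  "linf_norm M f = Max (insert 0 (f ` M))"

section \<open>Meshes and finite difference discretizations\<close>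

definition time_mesh :: "real \<Rightarrow> real \<Rightarrow> real set" where
  "time_mesh T \<tau> = {real k * \<tau> | k. k \<le> nat \<lfloor>T / \<tau>\<rfloor>}"

definition space_mesh :: "(real ^ 'n::finite) set \<Rightarrow> real \<Rightarrow> (real ^ 'n) set" where
  "space_mesh \<Omega> h = \<Omega> \<inter> {x. \<exists>J :: int ^ 'n. x = (\<chi> i. h * of_int (J $ i))}"

definition mesh :: "real \<Rightarrow> (real ^ 'n::finite) set \<Rightarrow> real \<Rightarrow> real \<Rightarrow> (real \<times> (real ^ 'n)) set" where
  "mesh T \<Omega> \<tau> h = time_mesh T \<tau> \<times> space_mesh \<Omega> h"

lemma finite_mesh:
  fixes \<Omega> :: "(real ^ 'n::finite) set"
  assumes "bounded \<Omega>" and "h > 0"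
  shows "finite (mesh T \<Omega> \<tau> h)"
proof -
  obtain B where B: "\<And>x. x \<in> \<Omega> \<Longrightarrow> norm x \<le> B"
    using assms(1) unfolding bounded_iff by blast
  define N where "N = \<lceil>B / h\<rceil>"
  have "space_mesh \<Omega> h \<subseteq> (\<lambda>f. \<chi> i. h * of_int (f i)) ` (UNIV \<rightarrow>\<^sub>E {-N..N})"
  proof
    fix x assume "x \<in> space_mesh \<Omega> h"
    then obtain J :: "int ^ 'n" where x: "x \<in> \<Omega>" "x = (\<chi> i. h * of_int (J $ i))"
      unfolding space_mesh_def by blast
    have "J $ i \<in> {-N..N}" for i
    proof -
      have "\<bar>h * of_int (J $ i)\<bar> \<le> B"
        using component_le_norm_cart[of x i] B[OF x(1)] x(2) by simp
      then have "\<bar>of_int (J $ i)\<bar> \<le> B / h"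
        using assms(2) by (simp add: abs_mult pos_le_divide_eq mult.commute)
      then show ?thesis
        unfolding N_def by (simp add: abs_le_iff) linarith
    qed
    then show "x \<in> (\<lambda>f. \<chi> i. h * of_int (f i)) ` (UNIV \<rightarrow>\<^sub>E {-N..N})"
      using x(2) by (intro image_eqI[of _ _ "\<lambda>i. J $ i"]) auto
  qed
  then have "finite (space_mesh \<Omega> h)"
    by (rule finite_subset) (simp add: finite_PiE)
  moreover have "finite (time_mesh T \<tau>)"
    unfolding time_mesh_def by simp
  ultimately show ?thesis
    unfolding mesh_def by blast
qed

text \<open>
  A discrete function on a mesh \<open>M\<close> is an element of \<open>M \<rightarrow>\<^sub>E UNIV\<close>. A discretization maps the step
  sizes \<open>\<tau>\<close>, \<open>h\<close>, a discrete function and a mesh point to a value; on a function \<open>u\<close> of continuous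
  arguments it is evaluated at \<open>mesh_values M u\<close>, so that it sees only mesh values of \<open>u\<close>.
\<close>

type_synonym ('z, 'v, 'b) discretization = "real \<Rightarrow> real \<Rightarrow> ('z \<Rightarrow> 'v) \<Rightarrow> 'z \<Rightarrow> 'b"

definition mesh_values :: "'z set \<Rightarrow> ('z \<Rightarrow> 'v) \<Rightarrow> 'z \<Rightarrow> 'v" where
  "mesh_values M u = restrict u M"

definition multiplier_discretization ::
  "('z, 'v, real ^ 'm::finite ^ 'm) discretization \<Rightarrow> ('z, 'v, real ^ 'm) discretization \<Rightarrow>
   ('z, 'v, real ^ 'm) discretization \<Rightarrow> ('z, 'v, real ^ 'm) discretization" where
  "multiplier_discretization \<Lambda>h Dt\<psi>h Dx\<Phi>h \<tau> h w z =
     matrix_inv (\<Lambda>h \<tau> h w z) *v (Dt\<psi>h \<tau> h w z + Dx\<Phi>h \<tau> h w z)"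

end

theory Submission
  imports Defs
begin

text \<open>
  The discretization multiplies the discrete conservation law by the inverse of the discrete multiplier
  matrix. At a mesh point, let \<open>A\<close> be that matrix and write \<open>F = A\<inverse> A F\<close>. Since \<open>\<Lambda> F = D\<^sub>t \<psi> + D\<^sub>x \<Phi>\<close> holds
  identically, the error of the scheme equals \<open>A\<inverse>\<close> applied to the three consistency errors:
  \<open>(A - \<Lambda>) F\<close>, the error of the density term and the error of the flux term. With \<open>\<parallel>A\<inverse>\<parallel> \<le> \<gamma>\<close> and a
  bound \<open>M\<close> for \<open>F[u]\<close>, this gives the rate \<open>h\<^sup>p + \<tau>\<^sup>q\<close> with a constant made of
  \<open>\<gamma> (C\<^sub>\<Lambda> M + C\<^sub>t + C\<^sub>x)\<close>. The algebraic part is \<open>multiplier_residual_bound\<close>.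

  Two points need analysis. First, \<open>M\<close> must not depend on the mesh: \<open>F[u]\<close> is the composition of a
  continuous function with the continuous jet of \<open>u\<close> on the compact closure of the space-time cylinder
  (\<open>differential_function_bounded\<close>).

  Second, the mesh contains the times \<open>t = 0\<close> and possibly \<open>t = T\<close>, whereas the identity for the
  multipliers is given over the open cylinder. It extends to the closure by continuity
  (\<open>multiplier_identity_on_closure\<close>), for which the partial derivatives of \<open>\<psi>\<close> and \<open>\<Phi>\<close> in the jet
  coordinates must be continuous. This is a property of power series in several variables, but only
  their values and first differences near the centre of an expansion matter: all terms of degree at
  least two contribute little to a difference quotient at any nearby base point
  (\<open>real_analytic_in_strict_partial\<close>). So the derivative at a nearby point, which exists because that
  point is the centre of another expansion, is close to the derivative at the centre
  (\<open>coord_deriv_tendsto\<close>).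
\<close>

section \<open>Monomial estimates\<close>

lemma abs_monomial_le:
  fixes y :: "'c \<Rightarrow> real"
  assumes "\<forall>c\<in>K. \<bar>y c\<bar> \<le> \<eta>"
  shows "\<bar>\<Prod>c\<in>K. y c ^ e c\<bar> \<le> \<eta> ^ sum e K"
proof -
  have "\<bar>\<Prod>c\<in>K. y c ^ e c\<bar> = (\<Prod>c\<in>K. \<bar>y c\<bar> ^ e c)"
    by (simp add: abs_prod power_abs)
  also have "\<dots> \<le> (\<Prod>c\<in>K. \<eta> ^ e c)"
    using assms by (intro prod_mono conjI power_mono) auto
  also have "\<dots> = \<eta> ^ sum e K"
    by (simp add: power_sum)
  finally show ?thesis .
qed

lemma abs_power_diff_le:
  fixes x y :: real
  assumes "\<bar>x\<bar> \<le> \<eta>" "\<bar>y\<bar> \<le> \<eta>"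
  shows "\<bar>x ^ k - y ^ k\<bar> \<le> \<bar>x - y\<bar> * (k * \<eta> ^ (k - 1))"
proof (cases k)
  case (Suc j)
  have "\<bar>\<Sum>i<k. y ^ (k - Suc i) * x ^ i\<bar> \<le> (\<Sum>i<k. \<eta> ^ (k - 1))"
  proof (rule order_trans[OF sum_abs sum_mono])
    fix i assume i: "i \<in> {..<k}"
    have "\<bar>y ^ (k - Suc i) * x ^ i\<bar> \<le> \<eta> ^ (k - Suc i) * \<eta> ^ i"
      unfolding abs_mult power_abs using assms by (intro mult_mono power_mono) auto
    also have "\<dots> = \<eta> ^ (k - 1)"
      using i by (simp flip: power_add)
    finally show "\<bar>y ^ (k - Suc i) * x ^ i\<bar> \<le> \<eta> ^ (k - 1)" .
  qed
  then have "\<bar>x - y\<bar> * \<bar>\<Sum>i<k. y ^ (k - Suc i) * x ^ i\<bar> \<le> \<bar>x - y\<bar> * (k * \<eta> ^ (k - 1))"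
    by (intro mult_left_mono) auto
  then show ?thesis
    by (simp add: power_diff_sumr2 abs_mult)
qed simp

text \<open>
  Changing one variable of a monomial of degree \<open>n\<close> costs a factor of order \<open>n \<eta>\<^bsup>n - 1\<^esup>\<close>: the degree
  drops by one, so for \<open>n \<ge> 2\<close> a positive power of \<open>\<eta>\<close> survives. This makes all but the linear terms
  of a power series negligible in difference quotients near the centre.
\<close>
lemma abs_monomial_update_diff_le:
  fixes y :: "'c \<Rightarrow> real"
  assumes "finite K" "c \<in> K" and y: "\<forall>k\<in>K. \<bar>y k\<bar> \<le> \<eta>" and s: "\<bar>s\<bar> \<le> \<eta>"
  shows "\<bar>(\<Prod>k\<in>K. (y(c := s)) k ^ e k) - (\<Prod>k\<in>K. y k ^ e k)\<bar>
    \<le> \<bar>s - y c\<bar> * (real (sum e K) * \<eta> ^ (sum e K - 1))"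
proof (cases "e c = 0")
  case True
  then have "(\<Prod>k\<in>K. (y(c := s)) k ^ e k) = (\<Prod>k\<in>K. y k ^ e k)"
    by (intro prod.cong) auto
  moreover have "0 \<le> \<eta>"
    using s by linarith
  ultimately show ?thesis
    by (simp add: sum_nonneg)
next
  case False
  have \<eta>: "0 \<le> \<eta>"
    using s by linarith
  let ?p = "\<Prod>k\<in>K - {c}. y k ^ e k"
  have e: "sum e K = e c + sum e (K - {c})"
    using assms(1,2) by (rule sum.remove)
  have "(\<Prod>k\<in>K. (y(c := s)) k ^ e k) = s ^ e c * ?p"
    using assms(1,2) by (simp add: prod.remove[of K c])
  moreover have "(\<Prod>k\<in>K. y k ^ e k) = y c ^ e c * ?p"
    using assms(1,2) by (simp add: prod.remove[of K c])
  ultimately have "\<bar>(\<Prod>k\<in>K. (y(c := s)) k ^ e k) - (\<Prod>k\<in>K. y k ^ e k)\<bar> = \<bar>s ^ e c - y c ^ e c\<bar> * \<bar>?p\<bar>"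
    by (simp add: abs_mult left_diff_distrib flip: abs_mult)
  also have "\<dots> \<le> (\<bar>s - y c\<bar> * (e c * \<eta> ^ (e c - 1))) * \<eta> ^ sum e (K - {c})"
    using assms \<eta> by (intro mult_mono abs_power_diff_le abs_monomial_le) auto
  also have "\<dots> = \<bar>s - y c\<bar> * (e c * (\<eta> ^ (e c - 1) * \<eta> ^ sum e (K - {c})))"
    by simp
  also have "\<eta> ^ (e c - 1) * \<eta> ^ sum e (K - {c}) = \<eta> ^ (sum e K - 1)"
    using False e by (simp flip: power_add)
  also have "\<bar>s - y c\<bar> * (e c * \<eta> ^ (sum e K - 1)) \<le> \<bar>s - y c\<bar> * (real (sum e K) * \<eta> ^ (sum e K - 1))"
    using \<eta> e by (intro mult_left_mono mult_right_mono) (auto simp del: of_nat_sum)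
  finally show ?thesis
    by simp
qed

text \<open>
  The terms of a power series seen by a difference quotient in the variable \<open>c\<close>: those free of \<open>c\<close>
  cancel, the linear one gives the derivative, and the others have degree at least two.
\<close>
lemma exponent_cases:
  fixes e :: "'c \<Rightarrow> nat"
  assumes "finite K" "c \<in> K" and off: "\<forall>k. k \<notin> K \<longrightarrow> e k = 0"
  shows "e c = 0 \<or> e = (\<lambda>_. 0)(c := 1) \<or> 2 \<le> sum e K"
proof -
  have e: "sum e K = e c + sum e (K - {c})"
    using assms(1,2) by (rule sum.remove)
  have "e = (\<lambda>_. 0)(c := 1)" if "e c = 1" "sum e (K - {c}) = 0"
  proof
    fix k
    have "\<forall>k\<in>K - {c}. e k = 0"
      using that(2) assms(1) by simp
    then show "e k = ((\<lambda>_. 0)(c := 1)) k"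
      using off that(1) by auto
  qed
  moreover have "e c = 0 \<or> (e c = 1 \<and> sum e (K - {c}) = 0) \<or> 2 \<le> sum e K"
    unfolding e by linarith
  ultimately show ?thesis
    by (elim disjE conjE) simp_all
qed

section \<open>Power series in jet coordinates\<close>

text \<open>
  Unconditional convergence on a cube with \<open>R\<close> inside its radius is, for real terms, absolute
  convergence at the corner where all variables equal \<open>R\<close>. The sum \<open>M\<close> there dominates all later
  estimates.
\<close>
lemma power_series_majorant:
  fixes K :: "('n, 'm) coord set"
  assumes "real_analytic_in K A f" "a \<in> A"
  obtains R M :: real and b where "0 < R" "0 \<le> M"
    and "((\<lambda>e. \<bar>b e\<bar> * R ^ sum e K) has_sum M) {e. \<forall>c. c \<notin> K \<longrightarrow> e c = 0}"
    and "\<forall>P. (\<forall>c\<in>K. \<bar>P c - a c\<bar> < R) \<longrightarrow>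
      ((\<lambda>e. b e * (\<Prod>c\<in>K. (P c - a c) ^ e c)) has_sum f P) {e. \<forall>c. c \<notin> K \<longrightarrow> e c = 0}"
proof -
  let ?E = "{e :: ('n, 'm) coord \<Rightarrow> nat. \<forall>c. c \<notin> K \<longrightarrow> e c = 0}"
  have "\<exists>\<rho>>0. \<exists>b. \<forall>P. (\<forall>c\<in>K. \<bar>P c - a c\<bar> < \<rho>) \<longrightarrow>
      ((\<lambda>e. b e * (\<Prod>c\<in>K. (P c - a c) ^ e c)) has_sum f P) ?E"
    using assms(1)[unfolded real_analytic_in_def] assms(2) by (rule bspec)
  then obtain \<rho> b where \<rho>: "\<rho> > 0"
    and ser: "\<forall>P. (\<forall>c\<in>K. \<bar>P c - a c\<bar> < \<rho>) \<longrightarrow>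
      ((\<lambda>e. b e * (\<Prod>c\<in>K. (P c - a c) ^ e c)) has_sum f P) ?E"
    by (elim exE conjE)
  define R where "R = \<rho> / 2"
  have R: "0 < R" "R < \<rho>"
    using \<rho> by (auto simp: R_def)
  have "((\<lambda>e. b e * (\<Prod>c\<in>K. R ^ e c)) has_sum f (\<lambda>c. a c + R)) ?E"
    using ser[rule_format, of "\<lambda>c. a c + R"] R by simp
  then have "(\<lambda>e. b e * R ^ sum e K) summable_on ?E"
    unfolding power_sum by (rule has_sum_imp_summable)
  then have "(\<lambda>e. norm (b e * R ^ sum e K)) summable_on ?E"
    by (rule iffD1[OF summable_on_iff_abs_summable_on_real])
  then obtain M where M: "((\<lambda>e. \<bar>b e\<bar> * R ^ sum e K) has_sum M) ?E"
    using R by (auto simp: summable_on_def abs_mult power_abs)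
  moreover have "0 \<le> M"
    using M by (rule has_sum_nonneg) (use R in auto)
  moreover have "((\<lambda>e. b e * (\<Prod>c\<in>K. (P c - a c) ^ e c)) has_sum f P) ?E"
    if "\<forall>c\<in>K. \<bar>P c - a c\<bar> < R" for P
    using that R(2) by (intro ser[rule_format]) fastforce
  ultimately show thesis
    using R(1) by (intro that[of R M b]) simp_all
qed

text \<open>
  For variables below \<open>\<delta> \<le> R\<close>, a nonconstant monomial is at most \<open>\<delta> / R\<close> times its value at the
  corner, so \<open>f\<close> differs from its value at the centre by at most \<open>\<delta> / R * M\<close>.
\<close>
lemma real_analytic_in_continuous_at:
  fixes K :: "('n, 'm) coord set"
  assumes "finite K" "real_analytic_in K A f" "a \<in> A" "\<epsilon> > 0"
  shows "\<exists>\<delta>>0. \<forall>P. (\<forall>k\<in>K. \<bar>P k - a k\<bar> < \<delta>) \<longrightarrow> \<bar>f P - f a\<bar> \<le> \<epsilon>"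
proof -
  let ?E = "{e. \<forall>c. c \<notin> K \<longrightarrow> e c = 0}"
  obtain R M b where R: "0 < R" and M: "0 \<le> M" "((\<lambda>e. \<bar>b e\<bar> * R ^ sum e K) has_sum M) ?E"
    and ser: "\<forall>P. (\<forall>c\<in>K. \<bar>P c - a c\<bar> < R) \<longrightarrow>
      ((\<lambda>e. b e * (\<Prod>c\<in>K. (P c - a c) ^ e c)) has_sum f P) ?E"
    by (rule power_series_majorant[OF assms(2) assms(3)])
  \<comment> \<open>dividing by \<open>M + 1\<close> rather than \<open>M\<close> covers the case \<open>M = 0\<close> of a vanishing series\<close>
  define \<delta> where "\<delta> = min R (\<epsilon> * R / (M + 1))"
  have \<delta>: "0 < \<delta>" "\<delta> \<le> R" "\<delta> * M \<le> \<epsilon> * R"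
  proof -
    show "\<delta> \<le> R"
      by (simp add: \<delta>_def)
    show "0 < \<delta>"
      using R M(1) assms(4) by (auto simp: \<delta>_def)
    have "\<delta> \<le> \<epsilon> * R / (M + 1)"
      by (simp add: \<delta>_def)
    then have "\<delta> * (M + 1) \<le> \<epsilon> * R"
      using M(1) by (simp add: field_simps)
    then show "\<delta> * M \<le> \<epsilon> * R"
      using \<open>0 < \<delta>\<close> by (simp add: algebra_simps)
  qed
  have "\<bar>f P - f a\<bar> \<le> \<epsilon>" if P: "\<forall>k\<in>K. \<bar>P k - a k\<bar> < \<delta>" for P
  proof -
    have "((\<lambda>e. b e * (\<Prod>c\<in>K. (P c - a c) ^ e c) + - (b e * (\<Prod>c\<in>K. (a c - a c) ^ e c))) has_sum f P + - f a) ?E"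
      using P \<delta> R by (intro has_sum_add has_sum_uminusI ser[rule_format]) force+
    moreover have "((\<lambda>e. \<delta> / R * (\<bar>b e\<bar> * R ^ sum e K)) has_sum \<delta> / R * M) ?E"
      using M(2) by (rule has_sum_cmult_right)
    ultimately have "norm (f P + - f a) \<le> \<delta> / R * M"
    proof (rule norm_infsum_le)
      fix e :: "('n, 'm) coord \<Rightarrow> nat" assume "e \<in> ?E"
      let ?d = "(\<Prod>c\<in>K. (P c - a c) ^ e c) - (\<Prod>c\<in>K. (a c - a c) ^ e c)"
      have "\<bar>?d\<bar> \<le> \<delta> / R * R ^ sum e K"
      proof (cases "sum e K")
        case 0
        have "e c = 0" if "c \<in> K" for c
          using 0 that assms(1) by simp
        then have "?d = 0"
          by simp
        then show ?thesis
          using \<delta> R by simp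
      next
        case (Suc j)
        then obtain c where "c \<in> K" "e c \<noteq> 0"
          by (metis nat.distinct(1) sum.neutral)
        then have "(\<Prod>c\<in>K. (a c - a c) ^ e c) = 0"
          using assms(1) by (intro prod_zero) (auto intro!: bexI[of _ c])
        then have "\<bar>?d\<bar> \<le> \<delta> ^ sum e K"
          using abs_monomial_le[of K "\<lambda>c. P c - a c" \<delta> e] P by force
        also have "\<dots> \<le> \<delta> * R ^ j"
          unfolding Suc power_Suc using \<delta> by (intro mult_left_mono power_mono) auto
        finally show ?thesis
          using Suc R by simp
      qed
      then have "\<bar>b e\<bar> * \<bar>?d\<bar> \<le> \<bar>b e\<bar> * (\<delta> / R * R ^ sum e K)"
        by (intro mult_left_mono) auto
      then show "norm (b e * (\<Prod>c\<in>K. (P c - a c) ^ e c) + - (b e * (\<Prod>c\<in>K. (a c - a c) ^ e c)))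
          \<le> \<delta> / R * (\<bar>b e\<bar> * R ^ sum e K)"
        by (simp add: ac_simps abs_mult flip: right_diff_distrib)
    qed
    also have "\<dots> \<le> \<epsilon>"
      using \<delta> R by (simp add: field_simps)
    finally show ?thesis
      by simp
  qed
  then show ?thesis
    using \<delta>(1) by (intro exI[of _ \<delta>]) simp
qed

text \<open>
  Strict differentiability in a single coordinate: the difference quotients are close to \<open>D\<close> at all
  base points near \<open>a\<close>, not only at \<open>a\<close>. This is what makes the partial derivative continuous at \<open>a\<close>
  without any termwise differentiation of the power series.
\<close>
definition strict_partial ::
  "'c set \<Rightarrow> 'c \<Rightarrow> (('c \<Rightarrow> real) \<Rightarrow> real) \<Rightarrow> ('c \<Rightarrow> real) \<Rightarrow> real \<Rightarrow> bool" where
  "strict_partial K c f a D \<longleftrightarrow>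
     (\<forall>\<epsilon>>0. \<exists>\<delta>>0. \<forall>P s. (\<forall>k\<in>K. \<bar>P k - a k\<bar> < \<delta>) \<longrightarrow> \<bar>s - a c\<bar> < \<delta> \<longrightarrow>
        \<bar>f (P(c := s)) - f P - D * (s - P c)\<bar> \<le> \<epsilon> * \<bar>s - P c\<bar>)"

text \<open>
  The derivative is the linear coefficient. With variables below \<open>\<delta> \<le> R / 2\<close>, the increment of a
  monomial of degree \<open>n \<ge> 2\<close> is at most \<open>n \<delta>\<^bsup>n - 1\<^esup>\<close> times the step; the factor \<open>n \<le> 2\<^bsup>n\<^esup>\<close> is absorbed by the
  halved radius, and one factor \<open>\<delta>\<close> remains to make the sum of all increments small.
\<close>
lemma real_analytic_in_strict_partial:
  fixes K :: "('n, 'm) coord set"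
  assumes K: "finite K" "c \<in> K" and "real_analytic_in K A f" "a \<in> A"
  shows "\<exists>D. strict_partial K c f a D"
proof -
  let ?E = "{e. \<forall>c. c \<notin> K \<longrightarrow> e c = 0}"
  obtain R M b where R: "0 < R" and M: "0 \<le> M" "((\<lambda>e. \<bar>b e\<bar> * R ^ sum e K) has_sum M) ?E"
    and ser: "\<forall>P. (\<forall>c\<in>K. \<bar>P c - a c\<bar> < R) \<longrightarrow>
      ((\<lambda>e. b e * (\<Prod>c\<in>K. (P c - a c) ^ e c)) has_sum f P) ?E"
    by (rule power_series_majorant[OF assms(3) assms(4)])
  define e1 :: "_ \<Rightarrow> nat" where "e1 = (\<lambda>_. 0)(c := 1)"
  have e1: "e1 \<in> ?E"
    using K(2) by (auto simp: e1_def)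
  have mono1: "(\<Prod>k\<in>K. y k ^ e1 k) = y c" for y :: "_ \<Rightarrow> real"
  proof -
    have "(\<Prod>k\<in>K. y k ^ e1 k) = y c ^ e1 c * (\<Prod>k\<in>K - {c}. y k ^ e1 k)"
      using K by (rule prod.remove)
    also have "(\<Prod>k\<in>K - {c}. y k ^ e1 k) = 1"
      by (rule prod.neutral) (simp add: e1_def)
    finally show ?thesis
      by (simp add: e1_def)
  qed
  have "strict_partial K c f a (b e1)"
    unfolding strict_partial_def
  proof (intro allI impI)
    fix \<epsilon> :: real assume \<epsilon>: "\<epsilon> > 0"
    \<comment> \<open>the remainder will be at most \<open>4 \<delta> M / R\<^sup>2\<close> times the step\<close>
    define \<delta> where "\<delta> = min (R / 2) (\<epsilon> * R\<^sup>2 / (4 * (M + 1)))"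
    have \<delta>: "0 < \<delta>" "\<delta> \<le> R / 2" "4 * \<delta> * M \<le> \<epsilon> * R\<^sup>2"
    proof -
      show "\<delta> \<le> R / 2"
        unfolding \<delta>_def by (rule min.cobounded1)
      show "0 < \<delta>"
        using R M(1) \<epsilon> by (auto simp: \<delta>_def)
      have "\<delta> \<le> \<epsilon> * R\<^sup>2 / (4 * (M + 1))"
        by (simp add: \<delta>_def)
      then have "\<delta> * (4 * (M + 1)) \<le> \<epsilon> * R\<^sup>2"
        using M(1) by (simp add: pos_le_divide_eq)
      then show "4 * \<delta> * M \<le> \<epsilon> * R\<^sup>2"
        using \<open>0 < \<delta>\<close> by (simp add: algebra_simps)
    qed
    have "\<bar>f (P(c := s)) - f P - b e1 * (s - P c)\<bar> \<le> \<epsilon> * \<bar>s - P c\<bar>"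
      if P: "\<forall>k\<in>K. \<bar>P k - a k\<bar> < \<delta>" and s: "\<bar>s - a c\<bar> < \<delta>" for P s
    proof -
      define y where "y = (\<lambda>k. P k - a k)"
      have y': "(P(c := s)) k - a k = (y(c := s - a c)) k" for k
        by (simp add: y_def)
      define m where "m = (\<lambda>y e. \<Prod>k\<in>K. (y k :: real) ^ e k)"
      have sum1: "((\<lambda>e. b e * m (y(c := s - a c)) e) has_sum f (P(c := s))) ?E"
        unfolding m_def y'[symmetric]
      proof (intro ser[rule_format])
        fix k assume "k \<in> K"
        then have "\<bar>P k - a k\<bar> < R"
          using P \<delta> R by fastforce
        then show "\<bar>(P(c := s)) k - a k\<bar> < R"
          using s \<delta> R by simp
      qed
      have sum2: "((\<lambda>e. b e * m y e) has_sum f P) ?E"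
        unfolding m_def y_def using P \<delta> R by (intro ser[rule_format]) fastforce
      have sum3: "((\<lambda>e. if e = e1 then b e1 * (s - P c) else 0) has_sum b e1 * (s - P c)) ?E"
        using e1 by (intro has_sum_finite_neutralI[of "{e1}"]) auto
      have sum4: "((\<lambda>e. b e * m (y(c := s - a c)) e + - (b e * m y e)
          + - (if e = e1 then b e1 * (s - P c) else 0)) has_sum
          f (P(c := s)) + - f P + - (b e1 * (s - P c))) ?E"
        using has_sum_add[OF has_sum_add[OF sum1 has_sum_uminusI[OF sum2]] has_sum_uminusI[OF sum3]] .
      have sum5: "((\<lambda>e. \<bar>s - P c\<bar> * (4 * \<delta> / R\<^sup>2) * (\<bar>b e\<bar> * R ^ sum e K))
          has_sum \<bar>s - P c\<bar> * (4 * \<delta> / R\<^sup>2) * M) ?E"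
        using M(2) by (rule has_sum_cmult_right)
      have "norm (f (P(c := s)) + - f P + - (b e1 * (s - P c)))
          \<le> \<bar>s - P c\<bar> * (4 * \<delta> / R\<^sup>2) * M"
      proof (rule norm_infsum_le[OF sum4 sum5])
        fix e :: "('n, 'm) coord \<Rightarrow> nat" assume e: "e \<in> ?E"
        let ?t = "b e * m (y(c := s - a c)) e + - (b e * m y e)
          + - (if e = e1 then b e1 * (s - P c) else 0)"
        have nonneg: "0 \<le> \<bar>s - P c\<bar> * (4 * \<delta> / R\<^sup>2) * (\<bar>b e\<bar> * R ^ sum e K)"
          using \<delta> R by simp
        have "e c = 0 \<or> e = e1 \<or> 2 \<le> sum e K"
          unfolding e1_def using K e by (intro exponent_cases) simp_all
        then consider "e c = 0" | "e = e1" | "2 \<le> sum e K"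
          by (elim disjE)
        then show "norm ?t \<le> \<bar>s - P c\<bar> * (4 * \<delta> / R\<^sup>2) * (\<bar>b e\<bar> * R ^ sum e K)"
        proof cases
          case 1
          then have "m (y(c := s - a c)) e = m y e"
            unfolding m_def by (intro prod.cong) auto
          moreover have "e \<noteq> e1"
            using 1 by (auto simp: e1_def)
          ultimately show ?thesis
            using nonneg by simp
        next
          case 2
          then have "?t = 0"
            by (simp add: m_def mono1 y_def algebra_simps)
          then show ?thesis
            using nonneg by simp
        next
          case 3
          define j where "j = sum e K - 2"
          with 3 have j: "sum e K = Suc (Suc j)"
            by simp
          have "e \<noteq> e1"
            using 3 K sum.remove[OF K, of e1] by (auto simp: e1_def)
          have "\<bar>m (y(c := s - a c)) e - m y e\<bar> \<le> \<bar>s - a c - y c\<bar> * (real (sum e K) * \<delta> ^ (sum e K - 1))"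
            unfolding m_def using P s K by (intro abs_monomial_update_diff_le) (auto simp: y_def less_imp_le)
          also have "\<dots> = \<bar>s - P c\<bar> * \<delta> * (real (sum e K) * \<delta> ^ j)"
            unfolding j by (simp add: y_def)
          \<comment> \<open>the halved radius pays for the factor \<open>2 ^ sum e K\<close> on the right, up to the constant \<open>4\<close>\<close>
          also have "\<dots> \<le> \<bar>s - P c\<bar> * \<delta> * (2 ^ sum e K * (R / 2) ^ j)"
          proof -
            have "real (sum e K) \<le> 2 ^ sum e K"
              by (metis of_nat_less_two_power less_imp_le)
            then show ?thesis
              using \<delta> by (intro mult_left_mono mult_mono power_mono) auto
          qed
          also have "\<dots> = \<bar>s - P c\<bar> * (4 * \<delta> / R\<^sup>2) * R ^ sum e K"
            unfolding j using R by (simp add: power_divide power2_eq_square)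
          finally have "\<bar>b e\<bar> * \<bar>m (y(c := s - a c)) e - m y e\<bar>
              \<le> \<bar>b e\<bar> * (\<bar>s - P c\<bar> * (4 * \<delta> / R\<^sup>2) * R ^ sum e K)"
            by (intro mult_left_mono) auto
          then show ?thesis
            using \<open>e \<noteq> e1\<close> by (simp add: ac_simps flip: abs_mult right_diff_distrib)
        qed
      qed
      also have "\<dots> = \<bar>s - P c\<bar> * (4 * \<delta> * M / R\<^sup>2)"
        by simp
      also have "\<dots> \<le> \<bar>s - P c\<bar> * \<epsilon>"
      proof (intro mult_left_mono)
        show "4 * \<delta> * M / R\<^sup>2 \<le> \<epsilon>"
          using \<delta>(3) R by (simp only: pos_divide_le_eq zero_less_power)
      qed simp
      finally show ?thesis
        by (simp add: ac_simps)
    qed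
    then show "\<exists>\<delta>>0. \<forall>P s. (\<forall>k\<in>K. \<bar>P k - a k\<bar> < \<delta>) \<longrightarrow> \<bar>s - a c\<bar> < \<delta> \<longrightarrow>
        \<bar>f (P(c := s)) - f P - b e1 * (s - P c)\<bar> \<le> \<epsilon> * \<bar>s - P c\<bar>"
      using \<delta>(1) by (intro exI[of _ \<delta>]) simp
  qed
  then show ?thesis ..
qed

section \<open>Continuity of partial and total derivatives\<close>

lemma eventually_uniformly_close:
  fixes a :: "'c \<Rightarrow> real"
  assumes "finite K" "\<And>k. k \<in> K \<Longrightarrow> ((\<lambda>i. Q i k) \<longlongrightarrow> a k) G" "\<delta> > 0"
  shows "\<forall>\<^sub>F i in G. \<forall>k\<in>K. \<bar>Q i k - a k\<bar> < \<delta>"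
  using assms by (intro eventually_ball_finite) (auto simp: tendsto_iff dist_real_def)

lemma real_analytic_in_tendsto:
  fixes K :: "('n, 'm) coord set"
  assumes "finite K" "real_analytic_in K A f" "a \<in> A"
    and lim: "\<And>k. k \<in> K \<Longrightarrow> ((\<lambda>i. Q i k) \<longlongrightarrow> a k) G"
  shows "((\<lambda>i. f (Q i)) \<longlongrightarrow> f a) G"
proof (rule tendstoI)
  fix \<epsilon> :: real assume "\<epsilon> > 0"
  then obtain \<delta> where "\<delta> > 0" and \<delta>: "\<forall>P. (\<forall>k\<in>K. \<bar>P k - a k\<bar> < \<delta>) \<longrightarrow> \<bar>f P - f a\<bar> \<le> \<epsilon> / 2"
    using real_analytic_in_continuous_at[OF assms(1-3), of "\<epsilon> / 2"] by auto
  have ev: "\<forall>\<^sub>F i in G. \<forall>k\<in>K. \<bar>Q i k - a k\<bar> < \<delta>"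
    using assms(1) lim \<open>\<delta> > 0\<close> by (rule eventually_uniformly_close)
  then show "\<forall>\<^sub>F i in G. dist (f (Q i)) (f a) < \<epsilon>"
  proof eventually_elim
    case (elim i)
    then have "\<bar>f (Q i) - f a\<bar> \<le> \<epsilon> / 2"
      using \<delta> by simp
    then show ?case
      using \<open>\<epsilon> > 0\<close> by (simp add: dist_real_def)
  qed
qed

lemma strict_partial_DERIV:
  assumes "strict_partial K c f a D"
  shows "((\<lambda>s. f (a(c := s))) has_field_derivative D) (at (a c))"
  unfolding has_field_derivative_def has_derivative_at_alt
proof (intro conjI allI impI)
  show "bounded_linear ((*) D)"
    by (rule bounded_linear_mult_right)
  fix \<epsilon> :: real assume "\<epsilon> > 0"
  then obtain \<delta> where "\<delta> > 0" and \<delta>: "\<forall>P s. (\<forall>k\<in>K. \<bar>P k - a k\<bar> < \<delta>) \<longrightarrow> \<bar>s - a c\<bar> < \<delta> \<longrightarrow>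
        \<bar>f (P(c := s)) - f P - D * (s - P c)\<bar> \<le> \<epsilon> * \<bar>s - P c\<bar>"
    using assms unfolding strict_partial_def by blast
  then show "\<exists>\<delta>>0. \<forall>s. norm (s - a c) < \<delta> \<longrightarrow>
      norm (f (a(c := s)) - f (a(c := a c)) - D * (s - a c)) \<le> \<epsilon> * norm (s - a c)"
    by (intro exI[of _ \<delta>]) simp
qed

lemma abs_derivative_diff_le:
  fixes g :: "real \<Rightarrow> real"
  assumes "(g has_field_derivative D') (at x)"
    and "\<forall>\<^sub>F y in at x. \<bar>g y - g x - D * (y - x)\<bar> \<le> \<epsilon> * \<bar>y - x\<bar>"
  shows "\<bar>D' - D\<bar> \<le> \<epsilon>"
proof (rule tendsto_upperbound)
  show "((\<lambda>y. \<bar>(g y - g x) / (y - x) - D\<bar>) \<longlongrightarrow> \<bar>D' - D\<bar>) (at x)"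
    using assms(1) by (intro tendsto_intros) (simp add: has_field_derivative_iff)
  have "\<forall>\<^sub>F y in at x. y \<noteq> x"
    by (simp add: eventually_at_filter)
  with assms(2) show "\<forall>\<^sub>F y in at x. \<bar>(g y - g x) / (y - x) - D\<bar> \<le> \<epsilon>"
  proof eventually_elim
    case (elim y)
    then have "(g y - g x) / (y - x) - D = (g y - g x - D * (y - x)) / (y - x)"
      by (simp add: field_simps)
    then show ?case
      using elim by (simp add: abs_divide pos_divide_le_eq)
  qed
qed simp

text \<open>
  Each \<open>Q i\<close> is itself the centre of a power series, so the derivative at \<open>Q i\<close> exists. It is a limit
  of difference quotients that strict differentiability at \<open>a\<close> keeps close to the derivative at \<open>a\<close>.
\<close>
lemma coord_deriv_tendsto:
  fixes K :: "('n, 'm) coord set"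
  assumes "finite K" "c \<in> K" and f: "real_analytic_in K A f" and "a \<in> A" and Q: "\<And>i. Q i \<in> A"
    and lim: "\<And>k. k \<in> K \<Longrightarrow> ((\<lambda>i. Q i k) \<longlongrightarrow> a k) G"
  shows "((\<lambda>i. coord_deriv c f (Q i)) \<longlongrightarrow> coord_deriv c f a) G"
proof -
  obtain D where D: "strict_partial K c f a D"
    using real_analytic_in_strict_partial[OF assms(1-4)] by blast
  have "coord_deriv c f a = D"
    unfolding coord_deriv_def using strict_partial_DERIV[OF D] by (rule DERIV_imp_deriv)
  moreover have "((\<lambda>i. coord_deriv c f (Q i)) \<longlongrightarrow> D) G"
  proof (rule tendstoI)
    fix \<epsilon> :: real assume "\<epsilon> > 0"
    then have "\<epsilon> / 2 > 0"
      by simp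
    then obtain \<delta> where "\<delta> > 0" and \<delta>: "\<forall>P s. (\<forall>k\<in>K. \<bar>P k - a k\<bar> < \<delta>) \<longrightarrow> \<bar>s - a c\<bar> < \<delta> \<longrightarrow>
        \<bar>f (P(c := s)) - f P - D * (s - P c)\<bar> \<le> \<epsilon> / 2 * \<bar>s - P c\<bar>"
      using D unfolding strict_partial_def by blast
    have "\<forall>\<^sub>F i in G. \<forall>k\<in>K. \<bar>Q i k - a k\<bar> < \<delta>"
      using assms(1) lim \<open>\<delta> > 0\<close> by (rule eventually_uniformly_close)
    then show "\<forall>\<^sub>F i in G. dist (coord_deriv c f (Q i)) D < \<epsilon>"
    proof eventually_elim
      case (elim i)
      obtain D' where "strict_partial K c f (Q i) D'"
        using real_analytic_in_strict_partial[OF assms(1-3) Q] by blast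
      then have D': "((\<lambda>s. f ((Q i)(c := s))) has_field_derivative D') (at (Q i c))"
        by (rule strict_partial_DERIV)
      have "\<forall>\<^sub>F s in at (Q i c). \<bar>s - a c\<bar> < \<delta>"
        using elim \<open>c \<in> K\<close> by (intro order_tendstoD(2)[of _ "\<bar>Q i c - a c\<bar>"] tendsto_intros) auto
      then have "\<forall>\<^sub>F s in at (Q i c).
          \<bar>f ((Q i)(c := s)) - f ((Q i)(c := Q i c)) - D * (s - Q i c)\<bar> \<le> \<epsilon> / 2 * \<bar>s - Q i c\<bar>"
      proof eventually_elim
        case (elim s)
        then show ?case
          using \<delta>[rule_format, of "Q i" s] \<open>\<forall>k\<in>K. \<bar>Q i k - a k\<bar> < \<delta>\<close> by simp
      qed
      with D' have "\<bar>D' - D\<bar> \<le> \<epsilon> / 2"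
        by (rule abs_derivative_diff_le)
      moreover have "coord_deriv c f (Q i) = D'"
        unfolding coord_deriv_def using D' by (rule DERIV_imp_deriv)
      ultimately show ?case
        using \<open>\<epsilon> > 0\<close> by (simp add: dist_real_def)
    qed
  qed
  ultimately show ?thesis
    by simp
qed

lemma finite_jet_coords: "finite (jet_coords N :: ('n::finite, 'm::finite) coord set)"
proof -
  have "{Dep \<alpha> j :: ('n, 'm) coord | \<alpha> j. size \<alpha> \<le> N} = case_prod Dep ` ({\<alpha>. size \<alpha> \<le> N} \<times> (UNIV :: 'm set))"
    by auto
  moreover have "finite (case_prod Dep ` ({\<alpha>. size \<alpha> \<le> N} \<times> (UNIV :: 'm set)) :: ('n, 'm) coord set)"
    by (intro finite_imageI finite_cartesian_product finite_multisets_size_le finite)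
  ultimately have "finite {Dep \<alpha> j :: ('n, 'm) coord | \<alpha> j. size \<alpha> \<le> N}"
    by (simp only:)
  then show ?thesis
    unfolding jet_coords_def by simp
qed

lemma total_deriv_tendsto:
  fixes f :: "('n::finite, 'm::finite) jet_point \<Rightarrow> real"
  assumes "real_analytic_in (jet_coords N) A f" "a \<in> A" "\<And>i. Q i \<in> A"
    and lim: "\<And>c. ((\<lambda>i. Q i c) \<longlongrightarrow> a c) G"
  shows "((\<lambda>i. total_deriv N v f (Q i)) \<longlongrightarrow> total_deriv N v f a) G"
proof -
  have "((\<lambda>i. coord_deriv c f (Q i)) \<longlongrightarrow> coord_deriv c f a) G" if "c \<in> jet_coords N" for c
    using finite_jet_coords that assms by (rule coord_deriv_tendsto)
  then show ?thesis
    unfolding total_deriv_def by (intro tendsto_intros lim) (auto simp: jet_coords_def)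
qed

section \<open>Extension of the multiplier identity to the closure\<close>

lemma tendsto_fun_iff:
  fixes Q :: "'i \<Rightarrow> 'c \<Rightarrow> real"
  shows "(Q \<longlongrightarrow> a) G \<longleftrightarrow> (\<forall>c. ((\<lambda>i. Q i c) \<longlongrightarrow> a c) G)"
  using limitin_componentwise[of "\<lambda>_. euclidean :: real topology" "UNIV :: 'c set" Q a G]
  by (simp add: euclidean_product_topology)

text \<open>
  Moving only the base point of a jet, with all derivative coordinates kept, approximates a jet over
  the boundary by jets over the open set.
\<close>
definition rebase_jet ::
  "('n::finite, 'm) jet_point \<Rightarrow> real \<times> (real ^ 'n) \<Rightarrow> ('n, 'm) jet_point" where
  "rebase_jet P z = (\<lambda>c. case c of Indep v \<Rightarrow> var_val z v | Dep \<alpha> j \<Rightarrow> P (Dep \<alpha> j))"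

lemma var_val_tendsto:
  assumes "(x \<longlongrightarrow> z) G"
  shows "((\<lambda>i. var_val (x i) v) \<longlongrightarrow> var_val z v) G"
  using assms by (cases v) (auto simp: var_val_def intro!: tendsto_intros)

lemma rebase_jet_in_jets_over: "rebase_jet P z \<in> jets_over A \<longleftrightarrow> z \<in> A"
  by (simp add: jets_over_def rebase_jet_def var_val_def)

text \<open>
  Both sides are continuous along jets that are moved from the interior to the boundary: the
  multipliers and total derivatives by analyticity, \<open>F\<close> by assumption. It is needed at the
  mesh points with \<open>t = 0\<close>, which lie on the boundary of the space-time cylinder.
\<close>
lemma multiplier_identity_on_closure:
  fixes S :: "(real \<times> (real ^ 'n::finite)) set" and F :: "('n, 'm::finite) jet_point \<Rightarrow> real ^ 'm"
  assumes "pde_system S d F" and CL: "conservation_law_multipliers S r d F \<Lambda> \<psi> \<Phi>"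
    and P: "P \<in> jets_over (closure S)"
  shows "\<Lambda> P *v F P = total_dt (max r d - 1) \<psi> P + total_div (max r d - 1) \<Phi> P"
proof -
  define N where "N = max r d - 1"
  note CL' = CL[unfolded conservation_law_multipliers_def, folded N_def]
  define z where "z = (P (Indep None), \<chi> i. P (Indep (Some i)))"
  have "z \<in> closure S"
    using P by (simp add: jets_over_def z_def)
  then obtain x where x: "\<And>n. x n \<in> S" and "x \<longlonglongrightarrow> z"
    unfolding closure_sequential by blast
  define Q where "Q n = rebase_jet P (x n)" for n
  have Q_S: "Q n \<in> jets_over S" for n
    using x by (simp add: Q_def rebase_jet_in_jets_over)
  then have Q: "Q n \<in> jets_over (closure S)" for n
    using closure_subset by (fastforce simp: jets_over_def)
  have lim: "(\<lambda>n. Q n c) \<longlonglongrightarrow> P c" for c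
  proof (cases c)
    case (Indep v)
    have "(\<lambda>n. var_val (x n) v) \<longlonglongrightarrow> var_val z v"
      using \<open>x \<longlonglongrightarrow> z\<close> by (rule var_val_tendsto)
    moreover have "var_val z v = P (Indep v)"
      by (simp add: var_val_def z_def split: option.split)
    ultimately show ?thesis
      by (simp add: Q_def rebase_jet_def Indep)
  qed (simp add: Q_def rebase_jet_def)
  have F: "(\<lambda>n. F (Q n)) \<longlonglongrightarrow> F P"
  proof (rule continuous_on_tendsto_compose[of "jets_over (closure S)" F Q P])
    show "continuous_on (jets_over (closure S)) F"
      using assms(1) by (simp add: pde_system_def)
    show "Q \<longlonglongrightarrow> P"
      using lim by (simp add: tendsto_fun_iff)
  qed (use P Q in auto)
  have \<Lambda>: "(\<lambda>n. \<Lambda> (Q n) $ i $ j) \<longlonglongrightarrow> \<Lambda> P $ i $ j" for i j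
    using CL' by (intro real_analytic_in_tendsto[OF finite_jet_coords _ P lim])
      auto
  have \<psi>: "(\<lambda>n. total_deriv N v (\<lambda>P. \<psi> P $ j) (Q n)) \<longlonglongrightarrow> total_deriv N v (\<lambda>P. \<psi> P $ j) P" for v j
    using CL' by (intro total_deriv_tendsto[OF _ P Q lim]) auto
  have \<Phi>: "(\<lambda>n. total_deriv N v (\<lambda>P. \<Phi> P $ j $ i) (Q n))
      \<longlonglongrightarrow> total_deriv N v (\<lambda>P. \<Phi> P $ j $ i) P" for v j i
    using CL' by (intro total_deriv_tendsto[OF _ P Q lim]) auto
  have "(\<lambda>n. \<Lambda> (Q n) *v F (Q n)) \<longlonglongrightarrow> \<Lambda> P *v F P"
    unfolding matrix_vector_mult_def by (intro vec_tendstoI) (auto intro!: tendsto_intros F \<Lambda>)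
  moreover have "(\<lambda>n. total_dt N \<psi> (Q n) + total_div N \<Phi> (Q n))
      \<longlonglongrightarrow> total_dt N \<psi> P + total_div N \<Phi> P"
    unfolding total_dt_def total_div_def
    by (intro tendsto_add vec_tendstoI) (auto intro!: tendsto_intros \<psi> \<Phi>)
  moreover have "\<Lambda> (Q n) *v F (Q n) = total_dt N \<psi> (Q n) + total_div N \<Phi> (Q n)" for n
    using CL' Q_S by blast
  ultimately show ?thesis
    unfolding N_def[symmetric] by (simp only: LIMSEQ_unique)
qed

section \<open>Boundedness of a differential function along a jet\<close>

lemma jet_in_jets_over: "jet S u z \<in> jets_over A \<longleftrightarrow> z \<in> A"
  by (simp add: jets_over_def jet_def var_val_def)

text \<open>
  The continuous extension that the class \<open>C\<^sup>k\<close> provides is the limit that defines the derivative on the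
  closure, because no point of the closure of an open set is isolated.
\<close>
lemma closure_partial_continuous_on:
  fixes u :: "real \<times> (real ^ 'n::finite) \<Rightarrow> 'b::real_normed_vector"
  assumes S: "open S" and u: "C_k_closure k S u" and \<alpha>: "size \<alpha> \<le> k"
  shows "continuous_on (closure S) (closure_partial S \<alpha> u)"
proof -
  define vs where "vs = (SOME vs. mset vs = \<alpha>)"
  have "mset vs = \<alpha>"
    unfolding vs_def by (rule someI_ex) (rule ex_mset)
  then have "length vs \<le> k"
    using \<alpha> by auto
  then obtain g where g: "continuous_on (closure S) g" "\<forall>y\<in>S. g y = iter_partial vs u y"
    using u unfolding C_k_closure_def by blast
  have "closure_partial S \<alpha> u z = g z" if z: "z \<in> closure S" for z
  proof -
    have "z islimpt S"
      using z S interior_limit_point[of z S] by (auto simp: closure_def interior_open)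
    then have "at z within S \<noteq> bot"
      by (simp add: trivial_limit_within)
    moreover have "(g \<longlongrightarrow> g z) (at z within S)"
      using g(1) z closure_subset by (meson continuous_on_def tendsto_within_subset)
    then have "(multi_partial \<alpha> u \<longlongrightarrow> g z) (at z within S)"
      by (rule Lim_transform_within[of _ _ _ _ 1]) (use g(2) in \<open>auto simp: multi_partial_def vs_def\<close>)
    ultimately show ?thesis
      unfolding closure_partial_def by (rule tendsto_Lim)
  qed
  then show ?thesis
    using g(1) by (simp cong: continuous_on_cong)
qed

text \<open>
  The full jet need not be continuous, since derivatives of order above \<open>k\<close> are arbitrary. As \<open>F\<close> sees
  only those of order at most \<open>d\<close>, the others can be set to zero; the truncated jet is continuous on a
  compact set.
\<close>
lemma differential_function_bounded:
  fixes S :: "(real \<times> (real ^ 'n::finite)) set" and F :: "('n, 'm::finite) jet_point \<Rightarrow> real ^ 'm"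
  assumes "open S" "bounded S" and F: "pde_system S d F" and u: "C_k_closure k S u" and "d \<le> k"
  shows "bounded ((\<lambda>z. F (jet S u z)) ` closure S)"
proof -
  define J where "J z = (\<lambda>c. case c of Indep v \<Rightarrow> var_val z v
    | Dep \<alpha> j \<Rightarrow> if size \<alpha> \<le> d then closure_partial S \<alpha> u z $ j else 0)" for z
  have J: "J z \<in> jets_over A \<longleftrightarrow> z \<in> A" for z A
    by (simp add: jets_over_def J_def var_val_def)
  have "continuous_on (closure S) (\<lambda>z. J z c)" for c
  proof (cases c)
    case (Indep v)
    then show ?thesis
      by (auto simp: J_def continuous_on_def intro!: var_val_tendsto)
  next
    case (Dep \<alpha> j)
    show ?thesis
    proof (cases "size \<alpha> \<le> d")
      case True
      then have "continuous_on (closure S) (closure_partial S \<alpha> u)"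
        using assms by (intro closure_partial_continuous_on[OF _ u]) auto
      then show ?thesis
        using True by (auto simp: J_def Dep intro!: continuous_intros)
    qed (simp add: J_def Dep)
  qed
  then have J_cont: "continuous_on (closure S) J"
    by (rule continuous_on_coordinatewise_then_product)
  have "continuous_on (closure S) (\<lambda>z. F (J z))"
  proof (rule continuous_on_compose2[OF _ J_cont])
    show "continuous_on (jets_over (closure S)) F"
      using F by (simp add: pde_system_def)
    show "J ` closure S \<subseteq> jets_over (closure S)"
      using J by blast
  qed
  moreover have "compact (closure S)"
    using assms(2) by simp
  ultimately have "bounded ((\<lambda>z. F (J z)) ` closure S)"
    by (intro compact_imp_bounded compact_continuous_image)
  moreover have "F (J z) = F (jet S u z)" if "z \<in> closure S" for z
  proof -
    have "\<forall>c\<in>jet_coords d. J z c = jet S u z c"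
      by (auto simp: jet_coords_def J_def jet_def)
    then show ?thesis
      using F that J[of z "closure S"] jet_in_jets_over[of S u z "closure S"]
      unfolding pde_system_def depends_only_on_def by blast
  qed
  ultimately show ?thesis
    by (simp cong: image_cong)
qed

section \<open>Operator norms for arbitrary vector norms\<close>

text \<open>
  A norm is convex, hence continuous in finite dimension, and attains its extrema on the unit sphere.
\<close>
lemma vector_norm_equivalent:
  fixes \<nu> :: "real ^ 'm::finite \<Rightarrow> real"
  assumes "vector_norm \<nu>"
  obtains c b where "0 < c" "\<And>v. c * norm v \<le> \<nu> v" "\<And>v. \<nu> v \<le> b * norm v"
proof -
  have \<nu>: "\<nu> v \<ge> 0" "\<nu> v = 0 \<longleftrightarrow> v = 0" "\<nu> (a *\<^sub>R v) = \<bar>a\<bar> * \<nu> v" "\<nu> (v + w) \<le> \<nu> v + \<nu> w" for a v w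
    using assms by (auto simp: vector_norm_def)
  have "convex_on UNIV \<nu>"
  proof (intro convex_onI)
    fix t :: real and x y :: "real ^ 'm" assume "0 < t" "t < 1"
    then show "\<nu> ((1 - t) *\<^sub>R x + t *\<^sub>R y) \<le> (1 - t) * \<nu> x + t * \<nu> y"
      using \<nu>(4)[of "(1 - t) *\<^sub>R x" "t *\<^sub>R y"] by (simp add: \<nu>(3))
  qed simp
  then have "continuous_on (sphere 0 1) \<nu>"
    using convex_on_continuous[OF open_UNIV] continuous_on_subset by blast
  moreover have ne: "sphere (0 :: real ^ 'm) 1 \<noteq> {}"
    by simp
  ultimately obtain x y where x: "x \<in> sphere 0 1" "\<forall>v\<in>sphere 0 1. \<nu> x \<le> \<nu> v"
    and y: "y \<in> sphere 0 1" "\<forall>v\<in>sphere 0 1. \<nu> v \<le> \<nu> y"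
    using continuous_attains_inf[of "sphere 0 1" \<nu>] continuous_attains_sup[of "sphere 0 1" \<nu>] by auto
  have scale: "\<nu> v = norm v * \<nu> (v /\<^sub>R norm v)" for v
    by (cases "v = 0") (simp_all add: \<nu>(2,3))
  have sph: "v /\<^sub>R norm v \<in> sphere 0 1" if "v \<noteq> 0" for v :: "real ^ 'm"
    using that by simp
  have zero: "\<nu> 0 = 0"
    by (simp add: \<nu>(2))
  show thesis
  proof
    show "0 < \<nu> x"
      using x(1) \<nu>(1,2)[of x] by (auto simp: less_le)
    show "\<nu> x * norm v \<le> \<nu> v" for v
      using x(2) sph[of v] zero by (cases "v = 0") (auto simp: scale[of v] mult.commute simp del: scaleR_eq_0_iff intro!: mult_left_mono)
    show "\<nu> v \<le> \<nu> y * norm v" for v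
      using y(2) sph[of v] zero by (cases "v = 0") (auto simp: scale[of v] mult.commute simp del: scaleR_eq_0_iff intro!: mult_left_mono)
  qed
qed

text \<open>
  Without this bound the supremum that defines the operator norm would carry no information.
\<close>
lemma op_norm_bdd_above:
  fixes \<nu> :: "real ^ 'm::finite \<Rightarrow> real"
  assumes "vector_norm \<nu>"
  shows "bdd_above (range (\<lambda>v. \<nu> (A *v v) / \<nu> v))"
proof -
  obtain c b where c: "0 < c" "\<And>v. c * norm v \<le> \<nu> v" and b: "\<And>v. \<nu> v \<le> b * norm v"
    using vector_norm_equivalent[OF assms] by blast
  have \<nu>: "\<nu> v \<ge> 0" "\<nu> v = 0 \<longleftrightarrow> v = 0" for v
    using assms by (auto simp: vector_norm_def)
  have b0: "0 \<le> b"
    using b[of "axis undefined 1"] \<nu>(1)[of "axis undefined 1"] by simp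
  have "\<nu> (A *v v) / \<nu> v \<le> b * onorm ((*v) A) / c" for v
  proof (cases "v = 0")
    case False
    then have pos: "0 < \<nu> v"
      using \<nu>[of v] by simp
    have "\<nu> (A *v v) \<le> b * (onorm ((*v) A) * norm v)"
      using b[of "A *v v"] onorm[OF matrix_vector_mul_bounded_linear, of A v] b0
      by (meson mult_left_mono order_trans)
    also have "\<dots> \<le> b * (onorm ((*v) A) * (\<nu> v / c))"
      using c b0 by (intro mult_left_mono onorm_pos_le matrix_vector_mul_bounded_linear)
        (simp_all add: pos_le_divide_eq mult.commute)
    finally show ?thesis
      using pos by (simp add: pos_divide_le_eq)
  qed (use b0 c(1) in \<open>simp add: \<nu> onorm_pos_le[OF matrix_vector_mul_bounded_linear]\<close>)
  then show ?thesis
    by (intro bdd_aboveI2)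
qed

lemma op_norm_bound:
  fixes \<nu> :: "real ^ 'm::finite \<Rightarrow> real"
  assumes "vector_norm \<nu>"
  shows "\<nu> (A *v v) \<le> op_norm \<nu> A * \<nu> v"
proof (cases "v = 0")
  case True
  moreover have "\<nu> 0 = 0"
    using assms unfolding vector_norm_def by blast
  ultimately show ?thesis
    by simp
next
  case False
  then have "0 < \<nu> v"
    using assms by (auto simp: vector_norm_def less_le)
  moreover have "\<nu> (A *v v) / \<nu> v \<le> op_norm \<nu> A"
    unfolding op_norm_def by (rule cSUP_upper) (use op_norm_bdd_above[OF assms] in auto)
  ultimately show ?thesis
    by (simp add: pos_divide_le_eq)
qed

lemma op_norm_nonneg:
  fixes \<nu> :: "real ^ 'm::finite \<Rightarrow> real"
  assumes "vector_norm \<nu>"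
  shows "0 \<le> op_norm \<nu> A"
proof -
  have "\<nu> (A *v 0) / \<nu> 0 \<le> op_norm \<nu> A"
    unfolding op_norm_def by (rule cSUP_upper) (use op_norm_bdd_above[OF assms] in auto)
  then show ?thesis
    using assms by (simp add: vector_norm_def)
qed

section \<open>Meshes and the consistency estimate\<close>

lemma le_linf_norm: "finite M \<Longrightarrow> z \<in> M \<Longrightarrow> f z \<le> linf_norm M f"
  unfolding linf_norm_def by (intro Max_ge) auto

lemma linf_norm_le: "finite M \<Longrightarrow> 0 \<le> B \<Longrightarrow> (\<And>z. z \<in> M \<Longrightarrow> f z \<le> B) \<Longrightarrow> linf_norm M f \<le> B"
  unfolding linf_norm_def by (intro Max.boundedI) auto

lemma mesh_subset_closure:
  assumes "T > 0" "\<tau> > 0"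
  shows "mesh T \<Omega> \<tau> h \<subseteq> closure ({0<..<T} \<times> \<Omega>)"
proof -
  have "time_mesh T \<tau> \<subseteq> {0..T}"
  proof
    fix t assume "t \<in> time_mesh T \<tau>"
    then obtain k where t: "t = real k * \<tau>" and k: "k \<le> nat \<lfloor>T / \<tau>\<rfloor>"
      by (auto simp: time_mesh_def)
    have "real k \<le> real_of_int \<lfloor>T / \<tau>\<rfloor>"
      using k assms by (simp add: le_nat_iff)
    then have "real k \<le> T / \<tau>"
      by linarith
    then show "t \<in> {0..T}"
      using assms t by (simp add: pos_le_divide_eq)
  qed
  then show ?thesis
    using assms(1) closure_subset[of \<Omega>]
    by (auto simp: mesh_def space_mesh_def closure_Times)
qed

text \<open>
  Writing \<open>f\<close> as \<open>A\<inverse> A f\<close> and inserting the identity \<open>L f = a + b\<close> turns the error into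
  \<open>A\<inverse> (- (L - A) f + (a - a') + (b - b'))\<close>.
\<close>
lemma multiplier_residual_bound:
  fixes \<nu> :: "real ^ 'm::finite \<Rightarrow> real"
  assumes \<nu>: "vector_norm \<nu>" and A: "invertible A" and id: "L *v f = a + b"
  shows "\<nu> (f - matrix_inv A *v (a' + b'))
    \<le> op_norm \<nu> (matrix_inv A) * (op_norm \<nu> (L - A) * \<nu> f + \<nu> (a - a') + \<nu> (b - b'))"
proof -
  have tri: "\<nu> (v + w) \<le> \<nu> v + \<nu> w" and neg: "\<nu> (- v) = \<nu> v" for v w
    using \<nu> unfolding vector_norm_def by (blast, metis abs_minus_cancel abs_one mult_1 scaleR_minus1_left)
  let ?R = "- ((L - A) *v f) + (a - a') + (b - b')"
  have "matrix_inv A ** A = mat 1"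
    using A unfolding invertible_def matrix_inv_def by (metis (mono_tags, lifting) someI_ex)
  then have "f = matrix_inv A *v (A *v f)"
    by (simp add: matrix_vector_mul_assoc)
  then have "f - matrix_inv A *v (a' + b') = matrix_inv A *v (A *v f - (a' + b'))"
    by (simp add: matrix_vector_mult_diff_distrib)
  also have "A *v f - (a' + b') = ?R"
    using id by (simp add: matrix_vector_mult_diff_rdistrib)
  finally have "\<nu> (f - matrix_inv A *v (a' + b')) \<le> op_norm \<nu> (matrix_inv A) * \<nu> ?R"
    using op_norm_bound[OF \<nu>] by simp
  also have "\<nu> ?R \<le> op_norm \<nu> (L - A) * \<nu> f + \<nu> (a - a') + \<nu> (b - b')"
    using tri[of "- ((L - A) *v f) + (a - a')" "b - b'"] tri[of "- ((L - A) *v f)" "a - a'"]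
      neg[of "(L - A) *v f"] op_norm_bound[OF \<nu>, of "L - A" f] by linarith
  finally show ?thesis
    using op_norm_nonneg[OF \<nu>] by (simp add: mult_left_mono)
qed

text \<open>
  The constant is independent of the step sizes because \<open>M\<close> bounds \<open>F[u]\<close> on the whole closed cylinder
  and not only on one mesh.
\<close>
theorem theorem4:
  fixes T :: real
    and \<Omega> :: "(real ^ 'n::finite) set"
    and S :: "(real \<times> (real ^ 'n)) set"
    and \<nu> :: "real ^ 'm::finite \<Rightarrow> real"
    and d r p q :: nat
    and F :: "('n, 'm) jet_point \<Rightarrow> real ^ 'm"
    and \<Lambda> :: "('n, 'm) jet_point \<Rightarrow> real ^ 'm ^ 'm"
    and \<psi> :: "('n, 'm) jet_point \<Rightarrow> real ^ 'm"
    and \<Phi> :: "('n, 'm) jet_point \<Rightarrow> real ^ 'n ^ 'm"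
    and u :: "real \<times> (real ^ 'n) \<Rightarrow> real ^ 'm"
    and H :: "(real \<times> real) set"
    and \<Lambda>h :: "(real \<times> (real ^ 'n), real ^ 'm, real ^ 'm ^ 'm) discretization"
    and Dt\<psi>h Dx\<Phi>h :: "(real \<times> (real ^ 'n), real ^ 'm, real ^ 'm) discretization"
    and C\<^sub>\<Lambda> C\<^sub>t C\<^sub>x \<gamma> :: real
    and V :: "real \<Rightarrow> real \<Rightarrow> (real \<times> (real ^ 'n) \<Rightarrow> real ^ 'm) set"
  assumes "T > 0"
    and "open \<Omega>" and "connected \<Omega>" and "\<Omega> \<noteq> {}" and "bounded \<Omega>"
    and S: "S = {0<..<T} \<times> \<Omega>"
    and "vector_norm \<nu>"
    and "pde_system S d F"
    and "C_k_closure (max p q + max r d) S u"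
    and "conservation_law_multipliers S r d F \<Lambda> \<psi> \<Phi>"
    and "H \<subseteq> {0<..} \<times> {0<..}"
    and "\<And>\<tau> h. (\<tau>, h) \<in> H \<Longrightarrow>
      linf_norm (mesh T \<Omega> \<tau> h)
        (\<lambda>z. op_norm \<nu> (\<Lambda> (jet S u z) - \<Lambda>h \<tau> h (mesh_values (mesh T \<Omega> \<tau> h) u) z))
      \<le> C\<^sub>\<Lambda> * (h ^ p + \<tau> ^ q)"
    and "\<And>\<tau> h. (\<tau>, h) \<in> H \<Longrightarrow>
      linf_norm (mesh T \<Omega> \<tau> h)
        (\<lambda>z. \<nu> (total_dt (max r d - 1) \<psi> (jet S u z) - Dt\<psi>h \<tau> h (mesh_values (mesh T \<Omega> \<tau> h) u) z))
      \<le> C\<^sub>t * (h ^ p + \<tau> ^ q)"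
    and "\<And>\<tau> h. (\<tau>, h) \<in> H \<Longrightarrow>
      linf_norm (mesh T \<Omega> \<tau> h)
        (\<lambda>z. \<nu> (total_div (max r d - 1) \<Phi> (jet S u z) - Dx\<Phi>h \<tau> h (mesh_values (mesh T \<Omega> \<tau> h) u) z))
      \<le> C\<^sub>x * (h ^ p + \<tau> ^ q)"
    and "\<And>\<tau> h. (\<tau>, h) \<in> H \<Longrightarrow> V \<tau> h \<subseteq> (mesh T \<Omega> \<tau> h \<rightarrow>\<^sub>E UNIV)"
    and "\<And>\<tau> h. (\<tau>, h) \<in> H \<Longrightarrow> mesh_values (mesh T \<Omega> \<tau> h) u \<in> V \<tau> h"
    and "\<And>\<tau> h u\<tau>h z. (\<tau>, h) \<in> H \<Longrightarrow> u\<tau>h \<in> V \<tau> h \<Longrightarrow> z \<in> mesh T \<Omega> \<tau> h \<Longrightarrow>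
      invertible (\<Lambda>h \<tau> h u\<tau>h z)"
    and "\<And>\<tau> h u\<tau>h. (\<tau>, h) \<in> H \<Longrightarrow> u\<tau>h \<in> V \<tau> h \<Longrightarrow>
      linf_norm (mesh T \<Omega> \<tau> h) (\<lambda>z. op_norm \<nu> (matrix_inv (\<Lambda>h \<tau> h u\<tau>h z))) \<le> \<gamma>"
  shows "\<exists>C>0. \<forall>(\<tau>, h) \<in> H.
    linf_norm (mesh T \<Omega> \<tau> h)
      (\<lambda>z. \<nu> (F (jet S u z)
        - multiplier_discretization \<Lambda>h Dt\<psi>h Dx\<Phi>h \<tau> h (mesh_values (mesh T \<Omega> \<tau> h) u) z))
    \<le> C * (h ^ p + \<tau> ^ q)"
proof -
  have S_open: "open S" and S_bdd: "bounded S"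
    using assms(2,5) by (auto simp: S open_Times bounded_Times)
  obtain M where M: "0 \<le> M" "\<And>z. z \<in> closure S \<Longrightarrow> \<nu> (F (jet S u z)) \<le> M"
  proof -
    obtain b where b: "\<And>v. \<nu> v \<le> b * norm v"
      using vector_norm_equivalent[OF \<open>vector_norm \<nu>\<close>] by blast
    have "d \<le> max p q + max r d"
      by simp
    then obtain B where B: "\<And>z. z \<in> closure S \<Longrightarrow> norm (F (jet S u z)) \<le> B"
      using differential_function_bounded[OF S_open S_bdd assms(8,9)] unfolding bounded_iff by blast
    have "\<nu> (F (jet S u z)) \<le> \<bar>b\<bar> * \<bar>B\<bar>" if "z \<in> closure S" for z
    proof -
      have "b * norm (F (jet S u z)) \<le> \<bar>b\<bar> * \<bar>B\<bar>"
        using B[OF that] by (intro mult_mono) auto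
      with b[of "F (jet S u z)"] show ?thesis
        by linarith
    qed
    then show thesis
      by (intro that[of "\<bar>b\<bar> * \<bar>B\<bar>"]) auto
  qed
  \<comment> \<open>Absolute values because the given constants may be negative if \<open>H\<close> is empty; the
     summand \<open>1\<close> makes \<open>C\<close> positive.\<close>
  define C where "C = \<bar>\<gamma>\<bar> * (\<bar>C\<^sub>\<Lambda>\<bar> * M + \<bar>C\<^sub>t\<bar> + \<bar>C\<^sub>x\<bar>) + 1"
  have "C > 0"
    using M(1) by (simp add: C_def add_nonneg_pos)
  moreover have "linf_norm (mesh T \<Omega> \<tau> h)
      (\<lambda>z. \<nu> (F (jet S u z)
        - multiplier_discretization \<Lambda>h Dt\<psi>h Dx\<Phi>h \<tau> h (mesh_values (mesh T \<Omega> \<tau> h) u) z))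
    \<le> C * (h ^ p + \<tau> ^ q)" if H: "(\<tau>, h) \<in> H" for \<tau> h
  proof (rule linf_norm_le)
    have pos: "\<tau> > 0" "h > 0"
      using H assms(11) by auto
    let ?M = "mesh T \<Omega> \<tau> h" and ?E = "h ^ p + \<tau> ^ q"
    let ?w = "mesh_values ?M u"
    show fin: "finite ?M"
      using assms(5) pos(2) by (rule finite_mesh)
    have E: "0 < ?E"
      using pos by (simp add: add_pos_pos)
    then show "0 \<le> C * ?E"
      using \<open>C > 0\<close> by simp
    fix z assume z: "z \<in> ?M"
    then have z_cl: "z \<in> closure S"
      using mesh_subset_closure[OF assms(1) pos(1)] S by blast
    let ?P = "jet S u z"
    let ?\<Lambda>h = "\<Lambda>h \<tau> h ?w z"
    have le_C: "x \<le> \<bar>c\<bar> * ?E" if "x \<le> c * ?E" for x c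
    proof -
      have "c * ?E \<le> \<bar>c\<bar> * ?E"
        using E by (intro mult_right_mono) auto
      with that show ?thesis
        by linarith
    qed
    have w: "?w \<in> V \<tau> h"
      using H by (rule assms(16))
    have e\<Lambda>: "op_norm \<nu> (\<Lambda> ?P - ?\<Lambda>h) \<le> \<bar>C\<^sub>\<Lambda>\<bar> * ?E"
      using order_trans[OF le_linf_norm[OF fin z] assms(12)[OF H]] by (rule le_C)
    have et: "\<nu> (total_dt (max r d - 1) \<psi> ?P - Dt\<psi>h \<tau> h ?w z) \<le> \<bar>C\<^sub>t\<bar> * ?E"
      using order_trans[OF le_linf_norm[OF fin z] assms(13)[OF H]] by (rule le_C)
    have ex: "\<nu> (total_div (max r d - 1) \<Phi> ?P - Dx\<Phi>h \<tau> h ?w z) \<le> \<bar>C\<^sub>x\<bar> * ?E"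
      using order_trans[OF le_linf_norm[OF fin z] assms(14)[OF H]] by (rule le_C)
    have inv: "op_norm \<nu> (matrix_inv ?\<Lambda>h) \<le> \<bar>\<gamma>\<bar>"
      using order_trans[OF le_linf_norm[OF fin z] assms(18)[OF H w]] by linarith
    have "\<Lambda> ?P *v F ?P = total_dt (max r d - 1) \<psi> ?P + total_div (max r d - 1) \<Phi> ?P"
      using assms(8,10) z_cl by (intro multiplier_identity_on_closure) (auto simp: jet_in_jets_over)
    then have "\<nu> (F ?P - multiplier_discretization \<Lambda>h Dt\<psi>h Dx\<Phi>h \<tau> h ?w z)
      \<le> op_norm \<nu> (matrix_inv ?\<Lambda>h) * (op_norm \<nu> (\<Lambda> ?P - ?\<Lambda>h) * \<nu> (F ?P)
        + \<nu> (total_dt (max r d - 1) \<psi> ?P - Dt\<psi>h \<tau> h ?w z)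
        + \<nu> (total_div (max r d - 1) \<Phi> ?P - Dx\<Phi>h \<tau> h ?w z))"
      unfolding multiplier_discretization_def
      using assms(7) assms(17)[OF H w z] by (intro multiplier_residual_bound)
    also have "\<dots> \<le> \<bar>\<gamma>\<bar> * ((\<bar>C\<^sub>\<Lambda>\<bar> * ?E) * M + \<bar>C\<^sub>t\<bar> * ?E + \<bar>C\<^sub>x\<bar> * ?E)"
    proof (rule mult_mono)
      have \<nu>_nonneg: "0 \<le> \<nu> v" for v
        using assms(7) by (simp add: vector_norm_def)
      have "op_norm \<nu> (\<Lambda> ?P - ?\<Lambda>h) * \<nu> (F ?P) \<le> (\<bar>C\<^sub>\<Lambda>\<bar> * ?E) * M"
        using e\<Lambda> M(2)[OF z_cl] _ \<nu>_nonneg by (rule mult_mono) (use E in simp)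
      then show "op_norm \<nu> (\<Lambda> ?P - ?\<Lambda>h) * \<nu> (F ?P)
          + \<nu> (total_dt (max r d - 1) \<psi> ?P - Dt\<psi>h \<tau> h ?w z)
          + \<nu> (total_div (max r d - 1) \<Phi> ?P - Dx\<Phi>h \<tau> h ?w z)
        \<le> (\<bar>C\<^sub>\<Lambda>\<bar> * ?E) * M + \<bar>C\<^sub>t\<bar> * ?E + \<bar>C\<^sub>x\<bar> * ?E"
        using et ex by linarith
      have "0 \<le> op_norm \<nu> (\<Lambda> ?P - ?\<Lambda>h) * \<nu> (F ?P)"
        using op_norm_nonneg[OF assms(7)] \<nu>_nonneg by (rule mult_nonneg_nonneg)
      then show "0 \<le> op_norm \<nu> (\<Lambda> ?P - ?\<Lambda>h) * \<nu> (F ?P)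
          + \<nu> (total_dt (max r d - 1) \<psi> ?P - Dt\<psi>h \<tau> h ?w z)
          + \<nu> (total_div (max r d - 1) \<Phi> ?P - Dx\<Phi>h \<tau> h ?w z)"
        using \<nu>_nonneg by (intro add_nonneg_nonneg)
    qed (use inv in simp_all)
    also have "\<dots> \<le> C * ?E"
      using E by (simp add: C_def algebra_simps)
    finally show "\<nu> (F ?P - multiplier_discretization \<Lambda>h Dt\<psi>h Dx\<Phi>h \<tau> h ?w z) \<le> C * ?E" .
  qed
  ultimately show ?thesis
    by blast
qed

end
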